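(* Let $G$ be a Roelcke-precompact non-archimedean Polish group, and let $\mathcal{A}_G$ be the linear span of the indicator functions of open cosets in $G$. Then every multiplicative linear functional $\tau\colon \mathcal{A}_G\to\mathbb{C}$ is positive and continuous (with respect to the supremum norm on $\mathcal{A}_G$).
   Context: A Polish group is a separable, completely metrizable topological group. A topological group $G$ is Roelcke-precompact if for every open neighborhood $U$ of the identity there is a finite $F\subseteq G$ with $G=UFU$. It is non-archimedean if the identity has a basis of neighborhoods consisting of open subgroups. An open coset of $G$ is a left translate $gU$ of an open subgroup $U$ of $G$. $\mathcal{A}_G$ is the complex linear span, in the algebra $C_b(G)$ of bounded continuous functions $G\to\mathbb{C}$, of the indicator functions of open cosets; it is a unital subalgebra of $C_b(G)$ (for pointwise operations), stable under complex conjugation, and is endowed with the norm $\|f\|_\infty=\sup_{g\in G}|f(g)|$. A linear functional $\tau$ on $\mathcal{A}_G$ is multiplicative if $\tau(f_1f_2)=\tau(f_1)\tau(f_2)$ for all $f_1,f_2\in\mathcal{A}_G$, and positive if $\tau(f)\geq 0$ for every $f\in\mathcal{A}_G$ with $f(g)\geq 0$ for all $g\in G$. *)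

theory Defs
  imports
    "HOL-Analysis.Analysis"
    "HOL-Algebra.Coset"
    "HOL-Library.Function_Algebras"
begin

section \<open>Topological groups\<close>

definition topological_group :: "('a, 'm) monoid_scheme \<Rightarrow> 'a topology \<Rightarrow> bool" where
  "topological_group G T \<longleftrightarrow>
     group G \<and> topspace T = carrier G \<and>
     continuous_map (prod_topology T T) T (\<lambda>(x, y). x \<otimes>\<^bsub>G\<^esub> y) \<and>
     continuous_map T T (\<lambda>x. inv\<^bsub>G\<^esub> x)"

definition polish_group :: "('a, 'm) monoid_scheme \<Rightarrow> 'a topology \<Rightarrow> bool" where
  "polish_group G T \<longleftrightarrow>
     topological_group G T \<and> separable_space T \<and> completely_metrizable_space T"

definition roelcke_precompact :: "('a, 'm) monoid_scheme \<Rightarrow> 'a topology \<Rightarrow> bool" where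
  "roelcke_precompact G T \<longleftrightarrow>
     (\<forall>U. openin T U \<and> \<one>\<^bsub>G\<^esub> \<in> U \<longrightarrow>
        (\<exists>F. finite F \<and> F \<subseteq> carrier G \<and> carrier G = U <#>\<^bsub>G\<^esub> F <#>\<^bsub>G\<^esub> U))"

definition open_subgroup :: "'a set \<Rightarrow> ('a, 'm) monoid_scheme \<Rightarrow> 'a topology \<Rightarrow> bool" where
  "open_subgroup U G T \<longleftrightarrow> subgroup U G \<and> openin T U"

definition non_archimedean :: "('a, 'm) monoid_scheme \<Rightarrow> 'a topology \<Rightarrow> bool" where
  "non_archimedean G T \<longleftrightarrow>
     (\<forall>V. openin T V \<and> \<one>\<^bsub>G\<^esub> \<in> V \<longrightarrow> (\<exists>U. open_subgroup U G T \<and> U \<subseteq> V))"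

definition open_cosets :: "('a, 'm) monoid_scheme \<Rightarrow> 'a topology \<Rightarrow> 'a set set" where
  "open_cosets G T = {g <#\<^bsub>G\<^esub> U | g U. g \<in> carrier G \<and> open_subgroup U G T}"

section \<open>The span of the indicator functions of open cosets\<close>

text \<open>Functions on the group are represented by functions on the whole type that vanish
  outside the carrier. Sums and products are the pointwise ones of
  \<^theory>\<open>HOL-Library.Function_Algebras\<close>.\<close>

definition cscale :: "complex \<Rightarrow> ('a \<Rightarrow> complex) \<Rightarrow> 'a \<Rightarrow> complex" where
  "cscale c f = (\<lambda>x. c * f x)"

interpretation cfun: vector_space "cscale :: complex \<Rightarrow> ('a \<Rightarrow> complex) \<Rightarrow> 'a \<Rightarrow> complex"
  by standard (simp_all add: cscale_def fun_eq_iff algebra_simps)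

definition coset_algebra ::
    "('a, 'm) monoid_scheme \<Rightarrow> 'a topology \<Rightarrow> ('a \<Rightarrow> complex) set" where
  "coset_algebra G T = cfun.span (indicator ` open_cosets G T)"

text \<open>The supremum is a genuine one only for functions that are bounded on the carrier; see
  \<open>coset_algebra_bounded\<close> below.\<close>

definition sup_norm :: "('a, 'm) monoid_scheme \<Rightarrow> ('a \<Rightarrow> complex) \<Rightarrow> real" where
  "sup_norm G f = (SUP g\<in>carrier G. norm (f g))"

section \<open>Functionals on a space of functions\<close>

text \<open>A functional on \<open>A\<close> is represented by a function on all complex-valued functions, whose
  values outside \<open>A\<close> are irrelevant.\<close>

definition linear_functional_on ::
    "('a \<Rightarrow> complex) set \<Rightarrow> (('a \<Rightarrow> complex) \<Rightarrow> complex) \<Rightarrow> bool" where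
  "linear_functional_on A \<tau> \<longleftrightarrow>
     (\<forall>f1\<in>A. \<forall>f2\<in>A. \<tau> (f1 + f2) = \<tau> f1 + \<tau> f2) \<and>
     (\<forall>c. \<forall>f\<in>A. \<tau> (cscale c f) = c * \<tau> f)"

definition multiplicative_on ::
    "('a \<Rightarrow> complex) set \<Rightarrow> (('a \<Rightarrow> complex) \<Rightarrow> complex) \<Rightarrow> bool" where
  "multiplicative_on A \<tau> \<longleftrightarrow> (\<forall>f1\<in>A. \<forall>f2\<in>A. \<tau> (f1 * f2) = \<tau> f1 * \<tau> f2)"

definition positive_functional_on ::
    "('a, 'm) monoid_scheme \<Rightarrow> ('a \<Rightarrow> complex) set \<Rightarrow> (('a \<Rightarrow> complex) \<Rightarrow> complex) \<Rightarrow> bool" where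
  "positive_functional_on G A \<tau> \<longleftrightarrow>
     (\<forall>f\<in>A. (\<forall>g\<in>carrier G. f g \<in> \<real>\<^sub>\<ge>\<^sub>0) \<longrightarrow> \<tau> f \<in> \<real>\<^sub>\<ge>\<^sub>0)"

definition sup_norm_continuous_on ::
    "('a, 'm) monoid_scheme \<Rightarrow> ('a \<Rightarrow> complex) set \<Rightarrow> (('a \<Rightarrow> complex) \<Rightarrow> complex) \<Rightarrow> bool" where
  "sup_norm_continuous_on G A \<tau> \<longleftrightarrow>
     (\<forall>f\<in>A. \<forall>\<epsilon>>0. \<exists>\<delta>>0. \<forall>h\<in>A. sup_norm G (h - f) < \<delta> \<longrightarrow> dist (\<tau> h) (\<tau> f) < \<epsilon>)"

section \<open>Boundedness and closure under products\<close>

lemma coset_algebra_bounded: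
  assumes "f \<in> coset_algebra G T"
  shows "bounded (range f)"
  using assms unfolding coset_algebra_def
proof (induction rule: cfun.span_induct_alt)
  case base
  then show ?case by (simp add: zero_fun_def image_constant_conv)
next
  case (step c x y)
  from step(1) obtain C where x: "x = indicator C" by auto
  obtain B where B: "\<And>t. norm (y t) \<le> B" using step(2) by (auto simp: bounded_iff)
  have "norm ((cscale c x + y) t) \<le> norm c + B" for t
  proof -
    have "norm ((cscale c x + y) t) \<le> norm (c * x t) + norm (y t)"
      by (simp add: cscale_def norm_triangle_ineq)
    also have "norm (c * x t) \<le> norm c"
      by (simp add: x indicator_def)
    finally show ?thesis using B[of t] by linarith
  qed
  then show ?case by (auto simp: bounded_iff)
qed

lemma open_cosets_Int:
  assumes "group G" "C \<in> open_cosets G T" "D \<in> open_cosets G T" "C \<inter> D \<noteq> {}"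
  shows "C \<inter> D \<in> open_cosets G T"
proof -
  interpret group G by fact
  from assms obtain a U b V where C: "C = a <#\<^bsub>G\<^esub> U" "a \<in> carrier G" "open_subgroup U G T"
    and D: "D = b <#\<^bsub>G\<^esub> V" "b \<in> carrier G" "open_subgroup V G T"
    by (auto simp: open_cosets_def)
  have U: "subgroup U G" and V: "subgroup V G" using C D by (auto simp: open_subgroup_def)
  from assms obtain x where x: "x \<in> C" "x \<in> D" by auto
  have xc: "x \<in> carrier G"
    using x(1) C U by (meson l_coset_subset_G subgroup.subset subsetD)
  have "C = x <#\<^bsub>G\<^esub> U" "D = x <#\<^bsub>G\<^esub> V"
    using x C D U V l_repr_independence by auto
  moreover have "(x <#\<^bsub>G\<^esub> U) \<inter> (x <#\<^bsub>G\<^esub> V) = x <#\<^bsub>G\<^esub> (U \<inter> V)"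
    using xc subgroup.mem_carrier[OF U] subgroup.mem_carrier[OF V]
    by (auto simp: l_coset_def)
  moreover have "open_subgroup (U \<inter> V) G T"
    using C D by (auto simp: open_subgroup_def subgroups_Inter_pair)
  ultimately show ?thesis
    using xc by (auto simp: open_cosets_def)
qed

lemma coset_algebra_mult:
  assumes "group G" "f \<in> coset_algebra G T" "h \<in> coset_algebra G T"
  shows "f * h \<in> coset_algebra G T"
proof -
  let ?I = "indicator ` open_cosets G T :: ('a \<Rightarrow> complex) set"
  have ind: "i * j \<in> cfun.span ?I" if "i \<in> ?I" "j \<in> ?I" for i j
  proof -
    from that obtain C D where CD: "i = indicator C" "j = indicator D"
      "C \<in> open_cosets G T" "D \<in> open_cosets G T" by auto
    then have eq: "i * j = indicator (C \<inter> D)"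
      by (auto simp: fun_eq_iff indicator_def)
    show ?thesis
    proof (cases "C \<inter> D = {}")
      case True
      then have "i * j = 0" by (simp add: eq fun_eq_iff)
      then show ?thesis by (simp add: cfun.span_zero)
    next
      case False
      then show ?thesis
        using open_cosets_Int[OF assms(1) CD(3,4)] eq by (auto intro: cfun.span_base)
    qed
  qed
  have left: "f * j \<in> cfun.span ?I" if "j \<in> ?I" for j
    using assms(2) unfolding coset_algebra_def
  proof (induction rule: cfun.span_induct_alt)
    case base
    have "0 * j = 0" by (simp add: fun_eq_iff)
    then show ?case by (simp only: cfun.span_zero)
  next
    case (step c x y)
    have "(cscale c x + y) * j = cscale c (x * j) + y * j"
      by (simp add: fun_eq_iff cscale_def algebra_simps)
    then show ?case
      using step that ind by (metis cfun.span_add cfun.span_scale)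
  qed
  show ?thesis
    using assms(3) unfolding coset_algebra_def
  proof (induction rule: cfun.span_induct_alt)
    case base
    have "f * 0 = 0" by (simp add: fun_eq_iff)
    then show ?case by (simp only: cfun.span_zero)
  next
    case (step c x y)
    have "f * (cscale c x + y) = cscale c (f * x) + f * y"
      by (simp add: fun_eq_iff cscale_def algebra_simps)
    then show ?case
      using step left by (metis cfun.span_add cfun.span_scale)
  qed
qed

end

theory Submission
  imports Defs
begin

text \<open>A finite linear combination of indicator functions takes only finitely many values, so every
  \<open>f\<close> in the coset algebra is annihilated by the polynomial \<open>\<Prod>\<^bsub>\<mu>\<^esub> (X - \<mu>)\<close>, where \<open>\<mu>\<close> ranges over
  the values of \<open>f\<close> on the group. The algebra has the unit \<open>e = indicator (carrier G)\<close>, because the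
  whole group is an open coset. If \<open>\<tau> e = 1\<close>, applying \<open>\<tau>\<close> to the polynomial identity gives
  \<open>\<Prod>\<^bsub>\<mu>\<^esub> (\<tau> f - \<mu>) = 0\<close>, hence \<open>\<tau> f\<close> is one of the values of \<open>f\<close>. Otherwise the idempotent \<open>\<tau> e\<close> is
  \<open>0\<close> and \<open>\<tau>\<close> vanishes, as \<open>\<tau> f = \<tau> f * \<tau> e\<close>. In both cases (lemma \<open>character_value\<close>) \<open>\<tau> f\<close> is
  nonnegative when \<open>f\<close> is, and \<open>\<bar>\<tau> f\<bar>\<close> is at most the supremum norm of \<open>f\<close>, so \<open>\<tau>\<close> is positive and
  contractive.\<close>

lemma linear_functional_on_diff:
  assumes "linear_functional_on (coset_algebra G T) \<tau>"
    and "f \<in> coset_algebra G T" and "h \<in> coset_algebra G T"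
  shows "\<tau> (f - h) = \<tau> f - \<tau> h"
proof -
  have eq: "f - h = f + cscale (-1) h"
    by (simp add: cscale_def fun_eq_iff)
  have "cscale (-1) h \<in> coset_algebra G T"
    using assms(3) unfolding coset_algebra_def by (rule cfun.span_scale)
  then have "\<tau> (f - h) = \<tau> f + (-1) * \<tau> h"
    using assms unfolding eq linear_functional_on_def by metis
  then show ?thesis by simp
qed

lemma coset_algebra_finite_range:
  assumes "f \<in> coset_algebra G T"
  shows "finite (range f)"
  using assms unfolding coset_algebra_def
proof (induction rule: cfun.span_induct_alt)
  case base
  then show ?case by (simp add: zero_fun_def image_constant_conv)
next
  case (step c x y)
  then obtain C where x: "x = indicator C" by auto
  have "range (cscale c x + y) \<subseteq> (\<lambda>(a, b). c * a + b) ` ({0, 1} \<times> range y)"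
    by (auto simp: x cscale_def indicator_def image_iff)
  moreover have "finite ((\<lambda>(a, b). c * a + b) ` ({0, 1} \<times> range y))"
    using step by blast
  ultimately show ?case by (rule finite_subset)
qed

lemma coset_algebra_vanishes_outside:
  assumes "group G" and "f \<in> coset_algebra G T" and "x \<notin> carrier G"
  shows "f x = 0"
  using assms(2) unfolding coset_algebra_def
proof (induction rule: cfun.span_induct_alt)
  case base
  then show ?case by simp
next
  case (step c i y)
  then obtain C where C: "C \<in> open_cosets G T" "i = indicator C" by auto
  interpret group G by fact
  have "C \<subseteq> carrier G"
    using C(1) by (auto simp: open_cosets_def open_subgroup_def l_coset_def
        dest: subgroup.mem_carrier)
  then have "i x = 0" using assms(3) C(2) by (auto simp: indicator_def)
  then show ?case using step by (simp add: cscale_def)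
qed

lemma unit_in_coset_algebra:
  assumes "topological_group G T"
  shows "indicator (carrier G) \<in> coset_algebra G T"
proof -
  interpret group G using assms by (simp add: topological_group_def)
  have "open_subgroup (carrier G) G T"
    using assms openin_topspace[of T]
    by (simp add: open_subgroup_def topological_group_def subgroup_self)
  moreover have "carrier G = \<one>\<^bsub>G\<^esub> <#\<^bsub>G\<^esub> carrier G"
    by (simp add: lcos_mult_one)
  ultimately have "carrier G \<in> open_cosets G T"
    unfolding open_cosets_def by blast
  then show ?thesis
    unfolding coset_algebra_def by (auto intro: cfun.span_base)
qed

text \<open>A unital homomorphism commutes with evaluation of polynomials; here the polynomial is the
  monic one with simple roots at the points of \<open>S\<close>. The factor \<open>indicator (carrier G)\<close> in \<open>p\<close> is
  the unit of the algebra: without it the empty product would be the constant \<open>1\<close> on the whole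
  type, which does not vanish outside the group.\<close>

lemma character_split_polynomial:
  assumes G: "topological_group G T"
    and lin: "linear_functional_on (coset_algebra G T) \<tau>"
    and mul: "multiplicative_on (coset_algebra G T) \<tau>"
    and unital: "\<tau> (indicator (carrier G)) = 1"
    and f: "f \<in> coset_algebra G T" and "finite S"
  defines "p \<equiv> \<lambda>S x. indicator (carrier G) x * (\<Prod>\<mu>\<in>S. f x - \<mu>)"
  shows "p S \<in> coset_algebra G T \<and> \<tau> (p S) = (\<Prod>\<mu>\<in>S. \<tau> f - \<mu>)"
  using \<open>finite S\<close>
proof (induction S rule: finite_induct)
  case empty
  then show ?case
    using unit_in_coset_algebra[OF G] unital by (simp add: p_def)
next
  case (insert c S)
  let ?A = "coset_algebra G T" and ?e = "indicator (carrier G) :: 'a \<Rightarrow> complex"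
  let ?q = "f - cscale c ?e"
  have grp: "group G" using G by (simp add: topological_group_def)
  have e: "?e \<in> ?A" by (rule unit_in_coset_algebra[OF G])
  have ce: "cscale c ?e \<in> ?A"
    using e unfolding coset_algebra_def by (rule cfun.span_scale)
  have q: "?q \<in> ?A"
    using f ce unfolding coset_algebra_def by (rule cfun.span_diff)
  have "\<tau> (cscale c ?e) = c"
    using lin e unital by (simp add: linear_functional_on_def)
  then have tq: "\<tau> ?q = \<tau> f - c"
    by (simp add: linear_functional_on_diff[OF lin f ce])
  have eq: "p (insert c S) = p S * ?q"
    using insert.hyps by (auto simp: p_def fun_eq_iff cscale_def indicator_def)
  have "p S * ?q \<in> ?A"
    using insert.IH q by (intro coset_algebra_mult[OF grp]) auto
  moreover have "\<tau> (p S * ?q) = \<tau> (p S) * \<tau> ?q"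
    using mul insert.IH q unfolding multiplicative_on_def by blast
  ultimately show ?case
    using insert.hyps insert.IH by (metis eq tq mult.commute prod.insert)
qed

text \<open>The alternative \<open>\<tau> f = 0\<close> covers the zero functional, which counts as multiplicative although
  it does not preserve the unit.\<close>

lemma character_value:
  assumes G: "topological_group G T"
    and lin: "linear_functional_on (coset_algebra G T) \<tau>"
    and mul: "multiplicative_on (coset_algebra G T) \<tau>"
    and f: "f \<in> coset_algebra G T"
  shows "\<tau> f = 0 \<or> \<tau> f \<in> f ` carrier G"
proof -
  let ?e = "indicator (carrier G) :: 'a \<Rightarrow> complex"
  have grp: "group G" using G by (simp add: topological_group_def)
  have e: "?e \<in> coset_algebra G T" by (rule unit_in_coset_algebra[OF G])
  have "?e * ?e = ?e" by (simp add: fun_eq_iff indicator_def)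
  then have "\<tau> ?e * \<tau> ?e = \<tau> ?e"
    using mul e unfolding multiplicative_on_def by metis
  then consider "\<tau> ?e = 0" | "\<tau> ?e = 1" by auto
  then show ?thesis
  proof cases
    case 1
    have "f * ?e = f"
      using coset_algebra_vanishes_outside[OF grp f] by (auto simp: fun_eq_iff indicator_def)
    then have "\<tau> f = \<tau> f * \<tau> ?e"
      using mul f e unfolding multiplicative_on_def by metis
    then show ?thesis using 1 by simp
  next
    case 2
    let ?S = "f ` carrier G"
    let ?p = "\<lambda>x. ?e x * (\<Prod>\<mu>\<in>?S. f x - \<mu>)"
    have fin: "finite ?S"
      using coset_algebra_finite_range[OF f] by (rule finite_subset[rotated]) auto
    have "?p x = cscale 0 f x" for x
      using fin by (auto simp: cscale_def indicator_def)
    then have "?p = cscale 0 f" by blast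
    moreover have "\<tau> (cscale 0 f) = 0"
      using lin f by (simp add: linear_functional_on_def del: cfun.scale_zero_left)
    ultimately have "\<tau> ?p = 0" by metis
    then have "(\<Prod>\<mu>\<in>?S. \<tau> f - \<mu>) = 0"
      using character_split_polynomial[OF G lin mul 2 f fin] by simp
    then show ?thesis using fin by (simp add: prod_zero_iff)
  qed
qed

lemma norm_le_sup_norm:
  assumes "f \<in> coset_algebra G T" and "g \<in> carrier G"
  shows "norm (f g) \<le> sup_norm G f"
proof -
  have "bdd_above ((\<lambda>g. norm (f g)) ` carrier G)"
    using coset_algebra_bounded[OF assms(1)] by (auto simp: bounded_iff bdd_above_def)
  then show ?thesis
    unfolding sup_norm_def using assms(2) by (rule cSUP_upper[rotated])
qed

lemma character_contractive:
  assumes G: "topological_group G T"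
    and "linear_functional_on (coset_algebra G T) \<tau>"
    and "multiplicative_on (coset_algebra G T) \<tau>"
    and f: "f \<in> coset_algebra G T"
  shows "norm (\<tau> f) \<le> sup_norm G f"
  using character_value[OF assms]
proof
  assume "\<tau> f = 0"
  moreover have "\<one>\<^bsub>G\<^esub> \<in> carrier G"
    using G by (simp add: topological_group_def group.is_monoid)
  ultimately show ?thesis
    using norm_le_sup_norm[OF f] norm_ge_zero order_trans by (metis norm_zero)
next
  assume "\<tau> f \<in> f ` carrier G"
  then show ?thesis using norm_le_sup_norm[OF f] by auto
qed

theorem theorem1:
  fixes G :: "('a, 'm) monoid_scheme" and T :: "'a topology"
    and \<tau> :: "('a \<Rightarrow> complex) \<Rightarrow> complex"
  assumes "polish_group G T" and "roelcke_precompact G T" and "non_archimedean G T"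
    and "linear_functional_on (coset_algebra G T) \<tau>"
    and "multiplicative_on (coset_algebra G T) \<tau>"
  shows "positive_functional_on G (coset_algebra G T) \<tau> \<and>
         sup_norm_continuous_on G (coset_algebra G T) \<tau>"
proof
  have G: "topological_group G T"
    using assms(1) by (simp add: polish_group_def)
  show "positive_functional_on G (coset_algebra G T) \<tau>"
    unfolding positive_functional_on_def
    using character_value[OF G assms(4,5)] by fastforce
  show "sup_norm_continuous_on G (coset_algebra G T) \<tau>"
    unfolding sup_norm_continuous_on_def
  proof (intro ballI allI impI)
    fix f and \<epsilon> :: real
    assume f: "f \<in> coset_algebra G T" and "\<epsilon> > 0"
    have "dist (\<tau> h) (\<tau> f) < \<epsilon>"
      if h: "h \<in> coset_algebra G T" and less: "sup_norm G (h - f) < \<epsilon>" for h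
    proof -
      have "h - f \<in> coset_algebra G T"
        using h f unfolding coset_algebra_def by (rule cfun.span_diff)
      then have "norm (\<tau> (h - f)) \<le> sup_norm G (h - f)"
        by (rule character_contractive[OF G assms(4,5)])
      then show ?thesis
        using less by (simp add: dist_norm linear_functional_on_diff[OF assms(4) h f])
    qed
    then show "\<exists>\<delta>>0. \<forall>h\<in>coset_algebra G T. sup_norm G (h - f) < \<delta> \<longrightarrow> dist (\<tau> h) (\<tau> f) < \<epsilon>"
      using \<open>\<epsilon> > 0\<close> by blast
  qed
qed

end
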